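(* Let $\eta(s)$ denote the entire function equal to $\sum_{n=1}^\infty(-1)^{n-1}n^{-s}$ for $\Re s>0$ (so $\eta(s)=(1-2^{1-s})\zeta(s)$). For all $s\in\mathbb{C}$ and all $s_0\in\mathbb{C}$ with $\Re s_0>-1$, $$\eta(s+s_0)=\frac{1}{\Gamma(s_0+1)}\sum_{m=0}^\infty(m+1)\left(\int_0^\infty\frac{x^{s_0}e^{-x(m+1)}}{(1+e^{-x})^{m+2}}\,dx\right)\sum_{j=0}^m\frac{(-1)^j\binom{m}{j}}{(j+1)^s}.$$ Furthermore, for all $s,s_0\in\mathbb{C}$, $$\eta(s+s_0)=\sum_{m=0}^\infty\frac{(-1)^m}{m!}\sum_{l=1}^{m+1}s(m+1,l)\,\eta(s_0+1-l)\sum_{j=0}^m\frac{(-1)^j\binom{m}{j}}{(j+1)^s}.$$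
   Context: $s(m+1,l)$ are the (signed) Stirling numbers of the first kind, defined by $x(x-1)\cdots(x-m)=\sum_{l}s(m+1,l)x^l$. *)

theory Defs
  imports "HOL-Analysis.Analysis" "HOL-Combinatorics.Stirling"
begin

text \<open>Dirichlet eta function: the (unique) entire function that equals
  \<open>\<Sum>n\<ge>1. (-1)^(n-1) n^(-s)\<close> for \<open>Re s > 0\<close>.
  The series (conditionally convergent for \<open>0 < Re s \<le> 1\<close>) is taken as the
  limit of its partial sums.\<close>
definition eta :: "complex \<Rightarrow> complex" where
  "eta = (THE f. f holomorphic_on UNIV \<and>
     (\<forall>s. Re s > 0 \<longrightarrow> f s = (\<Sum>n. (-1) ^ n / (of_nat (n + 1)) powr s)))"

text \<open>Signed Stirling numbers of the first kind, \<open>x(x-1)\<cdots>(x-n+1) = \<Sum>_l s(n,l) x^l\<close>;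
  obtained from the library's unsigned ones by the sign \<open>(-1)^(n-l)\<close>.\<close>
definition stirling1_signed :: "nat \<Rightarrow> nat \<Rightarrow> int" where
  "stirling1_signed n l = (-1) ^ (n - l) * int (stirling n l)"

end

theory Submission
  imports Defs "HOL-Complex_Analysis.Complex_Analysis" "HOL-Real_Asymp.Real_Asymp"
begin

text \<open>
  Write \<open>p\<^sub>s(j) = (j+1)^(-s)\<close> and \<open>D^k\<close> for the operator \<open>(D^k f)(n) = \<Sum>j. (-1)^j (k choose j) f(n+j)\<close>.
  Hasse's series \<open>\<eta>(s) = \<Sum>k. 2^(-k-1) (D^k p\<^sub>s)(0)\<close> converges for every \<open>s\<close>. Applied to
  \<open>p\<^bsub>s+s0\<^esub> = p\<^bsub>s0\<^esub> p\<^sub>s\<close>, the Leibniz rule turns it into the double series over \<open>m \<le> k\<close> of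
  \<open>2^(-k-1) (k choose m) (D^(k-m) p\<^bsub>s0\<^esub>)(m) (D^m p\<^sub>s)(0)\<close>. It converges absolutely because
  \<open>\<Sum>m. (k choose m) |(D^(k-m) p\<^sub>s)(m)|\<close> grows only polynomially in \<open>k\<close>: for \<open>Re s > 0\<close> it is bounded by
  \<open>\<Gamma>(Re s) / |\<Gamma>(s)|\<close>, and passing from \<open>s\<close> to \<open>s - 1\<close> costs a factor \<open>2k + 1\<close>.
  Summing over \<open>k\<close> first, the coefficient of \<open>(D^m p\<^sub>s)(0)\<close> is on the one hand the Stirling sum,
  since \<open>m! (j choose m) = \<Sum>l. s(m+1,l) (j+1)^(l-1)\<close>, and on the other hand the integral, since
  \<open>\<Gamma>(s) (D^i p\<^sub>s)(m)\<close> is the Mellin transform of \<open>z^(m+1) (1-z)^i\<close> at \<open>z = exp (-x)\<close>.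
\<close>

subsection \<open>Finite differences\<close>

text \<open>\<open>fdiff f i n\<close> is \<open>(-1)^i\<close> times the usual forward difference of order \<open>i\<close> at \<open>n\<close>.\<close>

definition fdiff :: "(nat \<Rightarrow> 'a::comm_ring_1) \<Rightarrow> nat \<Rightarrow> nat \<Rightarrow> 'a" where
  "fdiff f i n = (\<Sum>j\<le>i. (-1) ^ j * of_nat (i choose j) * f (n + j))"

lemma fdiff_0 [simp]: "fdiff f 0 n = f n"
  by (simp add: fdiff_def)

text \<open>Pascal's rule on the coefficients. This recurrence drives the later inductions on the
  order of the difference.\<close>

lemma fdiff_Suc: "fdiff f (Suc i) n = fdiff f i n - fdiff f i (Suc n)"
proof -
  have "fdiff f (Suc i) n
      = f n + (\<Sum>j\<le>i. (-1) ^ Suc j * of_nat (Suc i choose Suc j) * f (n + Suc j))"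
    unfolding fdiff_def by (subst sum.atMost_Suc_shift) simp
  also have "(\<Sum>j\<le>i. (-1) ^ Suc j * of_nat (Suc i choose Suc j) * f (n + Suc j))
      = (\<Sum>j\<le>i. (-1) ^ Suc j * of_nat (i choose Suc j) * f (n + Suc j)) - fdiff f i (Suc n)"
    unfolding fdiff_def sum_subtractf [symmetric]
    by (intro sum.cong) (simp_all add: algebra_simps)
  also have "f n + ((\<Sum>j\<le>i. (-1) ^ Suc j * of_nat (i choose Suc j) * f (n + Suc j)) - fdiff f i (Suc n))
      = (\<Sum>j\<le>Suc i. (-1) ^ j * of_nat (i choose j) * f (n + j)) - fdiff f i (Suc n)"
    by (subst sum.atMost_Suc_shift) simp
  also have "(\<Sum>j\<le>Suc i. (-1) ^ j * of_nat (i choose j) * f (n + j)) = fdiff f i n"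
    by (simp add: fdiff_def binomial_eq_0)
  finally show ?thesis .
qed

text \<open>A geometric sequence is an eigenvector of the shift, so each difference contributes one
  factor \<open>1 - z\<close>.\<close>

lemma fdiff_power: "fdiff (\<lambda>j. z ^ j) i n = z ^ n * (1 - z) ^ i"
  by (induction i arbitrary: n) (simp_all add: fdiff_Suc algebra_simps)

text \<open>The Leibniz rule for a linear factor, whose differences vanish beyond the first. For
  \<open>i = 0\<close> the truncated \<open>i - 1\<close> is harmless because its coefficient is 0.
  Since \<open>dpow (s - 1)\<close> is \<open>dpow s\<close> times \<open>j + 1\<close>, this
  controls the passage from \<open>s\<close> to \<open>s - 1\<close>.\<close>

lemma fdiff_mult_Suc:
  fixes f :: "nat \<Rightarrow> 'a::comm_ring_1"
  shows "fdiff (\<lambda>j. of_nat (Suc j) * f j) i n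
       = of_nat (Suc n) * fdiff f i n - of_nat i * fdiff f (i - 1) (Suc n)"
proof (induction i arbitrary: n)
  case (Suc i)
  have *: "of_nat i * fdiff f (i - 1) (Suc n) - of_nat i * fdiff f (i - 1) (Suc (Suc n))
      = of_nat i * fdiff f i (Suc n)"
    by (cases i) (simp_all add: fdiff_Suc algebra_simps)
  have "fdiff (\<lambda>j. of_nat (Suc j) * f j) (Suc i) n
      = of_nat (Suc n) * (fdiff f i n - fdiff f i (Suc n)) - fdiff f i (Suc n)
        - (of_nat i * fdiff f (i - 1) (Suc n) - of_nat i * fdiff f (i - 1) (Suc (Suc n)))"
    unfolding fdiff_Suc [of "\<lambda>j. of_nat (Suc j) * f j"] Suc.IH by (simp add: algebra_simps)
  then show ?case unfolding * by (simp add: fdiff_Suc algebra_simps)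
qed simp

text \<open>The discrete Leibniz rule. The first factor is evaluated at \<open>n + m\<close>, since
  each difference taken on \<open>g\<close> leaves \<open>f\<close> shifted by one.\<close>

lemma fdiff_times:
  "fdiff (\<lambda>j. f j * g j) k n = (\<Sum>m\<le>k. of_nat (k choose m) * fdiff f (k - m) (n + m) * fdiff g m n)"
proof (induction k arbitrary: n)
  case (Suc k)
  define T where "T = (\<lambda>m. fdiff f (Suc k - m) (n + m) * fdiff g m n)"
  have "fdiff (\<lambda>j. f j * g j) (Suc k) n
      = (\<Sum>m\<le>k. of_nat (k choose m) * fdiff f (k - m) (n + m) * fdiff g m n)
        - (\<Sum>m\<le>k. of_nat (k choose m) * fdiff f (k - m) (Suc n + m) * fdiff g m (Suc n))"
    by (simp add: fdiff_Suc Suc.IH)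
  \<comment> \<open>The mixed term \<open>fdiff f (k - m) (Suc (n + m)) * fdiff g m n\<close> occurs
    in \<open>T m\<close> and \<open>T (Suc m)\<close> with opposite signs and cancels.\<close>
  also have "\<dots> = (\<Sum>m\<le>k. of_nat (k choose m) * (T m + T (Suc m)))"
    unfolding sum_subtractf [symmetric]
  proof (intro sum.cong refl)
    fix m assume "m \<in> {..k}"
    then have "Suc k - m = Suc (k - m)" by auto
    then have T: "T m = (fdiff f (k - m) (n + m) - fdiff f (k - m) (Suc (n + m))) * fdiff g m n"
      by (simp add: T_def fdiff_Suc)
    have T': "T (Suc m) = fdiff f (k - m) (Suc (n + m)) * (fdiff g m n - fdiff g m (Suc n))"
      by (simp add: T_def fdiff_Suc)
    show "of_nat (k choose m) * fdiff f (k - m) (n + m) * fdiff g m n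
          - of_nat (k choose m) * fdiff f (k - m) (Suc n + m) * fdiff g m (Suc n)
        = of_nat (k choose m) * (T m + T (Suc m))"
      by (simp add: T T' algebra_simps)
  qed
  also have "\<dots> = (\<Sum>m\<le>k. of_nat (k choose m) * T m) + (\<Sum>m\<le>k. of_nat (k choose m) * T (Suc m))"
    by (simp add: sum.distrib algebra_simps)
  also have "(\<Sum>m\<le>k. of_nat (k choose m) * T m) = (\<Sum>m\<le>Suc k. of_nat (k choose m) * T m)"
    by (simp add: binomial_eq_0)
  also have "\<dots> = T 0 + (\<Sum>m\<le>k. of_nat (k choose Suc m) * T (Suc m))"
    by (subst sum.atMost_Suc_shift) simp
  also have "\<dots> + (\<Sum>m\<le>k. of_nat (k choose m) * T (Suc m))
      = T 0 + (\<Sum>m\<le>k. of_nat (Suc k choose Suc m) * T (Suc m))"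
    by (simp add: sum.distrib algebra_simps)
  also have "\<dots> = (\<Sum>m\<le>Suc k. of_nat (Suc k choose m) * T m)"
    by (subst sum.atMost_Suc_shift) simp
  finally show ?case by (simp add: T_def mult.assoc)
qed simp

text \<open>Rests on \<open>(k choose j) (j choose m) = (k choose m) (k - m choose j - m)\<close>;
  the index shift by \<open>m\<close> produces the sign. It identifies a Leibniz term as a
  difference at 0, to which the Hasse series applies.\<close>

lemma fdiff_binomial_mult:
  fixes f :: "nat \<Rightarrow> 'a::comm_ring_1"
  shows "fdiff (\<lambda>j. of_nat (j choose m) * f j) k 0 = (-1) ^ m * of_nat (k choose m) * fdiff f (k - m) m"
proof (cases "m \<le> k")
  case True
  have "fdiff (\<lambda>j. of_nat (j choose m) * f j) k 0
      = (\<Sum>j\<le>k. (-1) ^ j * of_nat ((k choose j) * (j choose m)) * f j)"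
    by (simp add: fdiff_def mult_ac)
  also have "\<dots> = (\<Sum>j\<in>{m..k}. (-1) ^ j * of_nat ((k choose j) * (j choose m)) * f j)"
    by (intro sum.mono_neutral_right) (auto simp: binomial_eq_0)
  also have "\<dots> = (\<Sum>j\<le>k - m. (-1) ^ (m + j) * of_nat ((k choose (m + j)) * ((m + j) choose m)) * f (m + j))"
    using True by (intro sum.reindex_bij_witness [of _ "\<lambda>j. m + j" "\<lambda>j. j - m"]) auto
  also have "\<dots> = (\<Sum>j\<le>k - m. (-1) ^ (m + j) * of_nat ((k choose m) * ((k - m) choose j)) * f (m + j))"
    using True by (intro sum.cong refl) (simp add: choose_mult del: of_nat_mult)
  also have "\<dots> = (-1) ^ m * of_nat (k choose m) * fdiff f (k - m) m"
    by (simp add: fdiff_def sum_distrib_left power_add mult_ac)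
  finally show ?thesis .
next
  case False
  then have "fdiff (\<lambda>j. of_nat (j choose m) * f j) k 0 = 0"
    unfolding fdiff_def by (intro sum.neutral) (auto simp: binomial_eq_0)
  with False show ?thesis by (simp add: binomial_eq_0)
qed

lemma fdiff_cmult: "fdiff (\<lambda>j. c * f j) i n = c * fdiff f i n"
  by (simp add: fdiff_def sum_distrib_left mult_ac)

lemma fdiff_sum: "fdiff (\<lambda>j. \<Sum>l\<in>L. f l j) i n = (\<Sum>l\<in>L. fdiff (f l) i n)"
  unfolding fdiff_def sum_distrib_left by (rule sum.swap)

text \<open>At \<open>x = j + 1\<close> the falling factorial \<open>x (x-1) ... (x-m)\<close>
  equals \<open>x\<close> times \<open>m! (j choose m)\<close>. Cancelling \<open>x\<close> lowers
  each exponent to \<open>l - 1\<close>.\<close>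

lemma fact_mult_choose_eq_stirling:
  "(fact m * of_nat (j choose m) :: complex)
     = (\<Sum>l=1..m+1. of_int (stirling1_signed (m + 1) l) * of_nat (j + 1) ^ (l - 1))"
proof -
  define x :: complex where "x = of_nat (j + 1)"
  have x: "x \<noteq> 0" unfolding x_def of_nat_eq_0_iff by simp
  have "x * (\<Sum>l=1..m+1. of_int (stirling1_signed (m + 1) l) * x ^ (l - 1))
      = (\<Sum>l=1..m+1. of_int (stirling1_signed (m + 1) l) * x ^ l)"
    unfolding sum_distrib_left by (intro sum.cong refl) (auto simp: power_eq_if)
  \<comment> \<open>The signs are absorbed into \<open>- x\<close>, so that the rising factorial
    identity for unsigned Stirling numbers applies.\<close>
  also have "\<dots> = (\<Sum>l=1..m+1. (-1) ^ (m + 1) * (of_nat (stirling (m + 1) l) * (- x) ^ l))"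
  proof (intro sum.cong refl)
    fix l assume l: "l \<in> {1..m+1}"
    then have "(-1 :: complex) ^ (m + 1 - l) = (-1) ^ (m + 1) * (-1) ^ l"
      by (simp add: minus_one_power_iff)
    then show "of_int (stirling1_signed (m + 1) l) * x ^ l
        = (-1) ^ (m + 1) * (of_nat (stirling (m + 1) l) * (- x) ^ l)"
      by (simp add: stirling1_signed_def power_minus [of x])
  qed
  \<comment> \<open>The added term \<open>l = 0\<close> vanishes because
    \<open>stirling (m + 1) 0 = 0\<close>.\<close>
  also have "\<dots> = (-1) ^ (m + 1) * (\<Sum>l\<le>m+1. of_nat (stirling (m + 1) l) * (- x) ^ l)"
    unfolding sum_distrib_left by (intro sum.mono_neutral_left) (auto simp: not_le less_Suc_eq_0_disj)
  also have "\<dots> = (-1) ^ (m + 1) * pochhammer (- x) (m + 1)"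
    by (simp only: stirling_pochhammer)
  also have "\<dots> = fact (m + 1) * (x gchoose (m + 1))"
    by (simp add: gbinomial_pochhammer del: fact_Suc)
  also have "x gchoose (m + 1) = of_nat ((j + 1) choose (m + 1))"
    unfolding x_def by (simp only: binomial_gbinomial)
  also have "fact (m + 1) * of_nat ((j + 1) choose (m + 1))
      = (fact m * of_nat (Suc m * (Suc j choose Suc m)) :: complex)"
    by (simp only: Suc_eq_plus1 [symmetric] fact_Suc of_nat_mult mult_ac)
  also have "\<dots> = x * (fact m * of_nat (j choose m))"
    by (simp only: Suc_times_binomial) (simp add: x_def algebra_simps)
  finally show ?thesis using x by (simp add: x_def)
qed

subsection \<open>Mellin integrals\<close>

abbreviation mellin_kernel :: "complex \<Rightarrow> (real \<Rightarrow> real) \<Rightarrow> real \<Rightarrow> complex" where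
  "mellin_kernel s p \<equiv> (\<lambda>x. of_real x powr (s - 1) * of_real (p x))"

definition mellin :: "complex \<Rightarrow> (real \<Rightarrow> real) \<Rightarrow> complex" where
  "mellin s p = (LBINT x:{0<..}. mellin_kernel s p x)"

lemma mellin_kernel_measurable:
  assumes "continuous_on {0<..} p"
  shows "set_borel_measurable borel {0<..} (mellin_kernel s p)"
  unfolding set_borel_measurable_def
  by (intro borel_measurable_continuous_on_indicator continuous_intros assms) auto

text \<open>Carries Euler's integral over from the completed measure and the gauge integral to
  \<open>lborel\<close>; Borel measurability of the integrand removes the completion.\<close>

lemma
  assumes "Re s > 0"
  shows mellin_exp_integrable: "set_integrable lborel {0<..} (mellin_kernel s (\<lambda>x. exp (-x)))"
    and mellin_exp: "mellin s (\<lambda>x. exp (-x)) = Gamma s"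
proof -
  define f where "f = mellin_kernel s (\<lambda>x. exp (-x))"
  have eq: "f = (\<lambda>t. complex_of_real t powr (s - 1) / of_real (exp t))"
    by (simp add: f_def exp_minus field_simps)
  have abs: "f absolutely_integrable_on {0<..}"
    unfolding eq by (rule absolutely_integrable_Gamma_integral' [OF assms])
  have meas: "(\<lambda>x. indicator {0<..} x *\<^sub>R f x) \<in> borel_measurable lborel"
    using mellin_kernel_measurable [of "\<lambda>x. exp (-x)" s]
    by (simp add: f_def set_borel_measurable_def continuous_intros)
  show "set_integrable lborel {0<..} (mellin_kernel s (\<lambda>x. exp (-x)))"
    using abs meas unfolding f_def [symmetric] set_integrable_def
    by (simp add: integrable_completion)
  have "mellin s (\<lambda>x. exp (-x)) = (LINT x:{0<..}|lebesgue. f x)"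
    using meas unfolding mellin_def f_def [symmetric] set_lebesgue_integral_def
    by (simp add: integral_completion)
  also have "\<dots> = integral {0<..} f"
    by (rule set_lebesgue_integral_eq_integral(2) [OF abs])
  also have "\<dots> = Gamma s"
    unfolding eq by (rule integral_unique [OF Gamma_integral_complex' [OF assms]])
  finally show "mellin s (\<lambda>x. exp (-x)) = Gamma s" .
qed

lemma mellin_integrable:
  assumes "Re s > 0" "continuous_on {0<..} p" "\<And>x. x > 0 \<Longrightarrow> \<bar>p x\<bar> \<le> C * exp (-x)"
  shows "set_integrable lborel {0<..} (mellin_kernel s p)"
proof (rule set_integrable_bound)
  show "set_integrable lborel {0<..} (\<lambda>x. of_real C * mellin_kernel s (\<lambda>x. exp (-x)) x)"
    by (intro set_integrable_mult_right mellin_exp_integrable assms)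
  show "set_borel_measurable lborel {0<..} (mellin_kernel s p)"
    using mellin_kernel_measurable [OF assms(2), of s] by (simp add: set_borel_measurable_def)
  show "AE x in lborel. x \<in> {0<..} \<longrightarrow>
      norm (mellin_kernel s p x) \<le> norm (of_real C * mellin_kernel s (\<lambda>x. exp (-x)) x)"
  proof (intro AE_I2 impI)
    fix x :: real assume "x \<in> {0<..}"
    \<comment> \<open>The sign of \<open>C\<close> is not prescribed, and the norm of the majorant
      involves \<open>\<bar>C\<bar>\<close>.\<close>
    then have "\<bar>p x\<bar> \<le> \<bar>C\<bar> * exp (-x)"
      using assms(3) [of x] by (meson abs_ge_self exp_ge_zero greaterThan_iff mult_right_mono order_trans)
    then have "norm (of_real x powr (s - 1)) * \<bar>p x\<bar> \<le> norm (of_real x powr (s - 1)) * (\<bar>C\<bar> * exp (-x))"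
      by (intro mult_left_mono) auto
    then show "norm (mellin_kernel s p x) \<le> norm (of_real C * mellin_kernel s (\<lambda>x. exp (-x)) x)"
      by (simp add: norm_mult mult_ac)
  qed
qed

text \<open>Dominated convergence with a multiple of the Gamma integrand as majorant. It justifies
  the termwise integration of both series for eta.\<close>

lemma mellin_tendsto:
  assumes s: "Re s > 0"
    and cont: "\<And>n. continuous_on {0<..} (p n)" "continuous_on {0<..} q"
    and bound: "\<And>n x. x > 0 \<Longrightarrow> \<bar>p n x\<bar> \<le> C * exp (-x)"
    and lim: "\<And>x. x > 0 \<Longrightarrow> (\<lambda>n. p n x) \<longlonglongrightarrow> q x"
  shows "(\<lambda>n. mellin s (p n)) \<longlonglongrightarrow> mellin s q"
  unfolding mellin_def set_lebesgue_integral_def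
proof (rule integral_dominated_convergence)
  let ?w = "\<lambda>x. of_real C * (mellin_kernel s (\<lambda>x. exp (-x)) x)"
  show "integrable lborel (\<lambda>x. norm (indicator {0<..} x *\<^sub>R ?w x))"
    using set_integrable_mult_right [of C lborel "{0<..}" "mellin_kernel s (\<lambda>x. exp (-x))", OF mellin_exp_integrable [OF s]]
    unfolding set_integrable_def by (rule integrable_norm)
  show "(\<lambda>x. indicator {0<..} x *\<^sub>R mellin_kernel s q x) \<in> borel_measurable lborel"
    using mellin_kernel_measurable [OF cont(2), of s] by (simp add: set_borel_measurable_def)
  show "(\<lambda>x. indicator {0<..} x *\<^sub>R mellin_kernel s (p n) x) \<in> borel_measurable lborel" for n
    using mellin_kernel_measurable [OF cont(1), of s] by (simp add: set_borel_measurable_def)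
  show "AE x in lborel. (\<lambda>n. indicator {0<..} x *\<^sub>R mellin_kernel s (p n) x)
      \<longlonglongrightarrow> indicator {0<..} x *\<^sub>R mellin_kernel s q x"
  proof (intro AE_I2)
    fix x :: real
    show "(\<lambda>n. indicator {0<..} x *\<^sub>R mellin_kernel s (p n) x)
      \<longlonglongrightarrow> indicator {0<..} x *\<^sub>R mellin_kernel s q x"
      using lim [of x] by (cases "x > 0") (auto intro!: tendsto_intros)
  qed
  show "AE x in lborel. norm (indicator {0<..} x *\<^sub>R mellin_kernel s (p n) x)
      \<le> norm (indicator {0<..} x *\<^sub>R ?w x)" for n
  proof (intro AE_I2)
    fix x :: real
    show "norm (indicator {0<..} x *\<^sub>R mellin_kernel s (p n) x) \<le> norm (indicator {0<..} x *\<^sub>R ?w x)"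
    proof (cases "x > 0")
      case True
      then have "\<bar>p n x\<bar> \<le> \<bar>C\<bar> * exp (-x)"
        using bound [of x n] by (meson abs_ge_self exp_ge_zero mult_right_mono order_trans)
      then have "norm (of_real x powr (s - 1)) * \<bar>p n x\<bar> \<le> norm (of_real x powr (s - 1)) * (\<bar>C\<bar> * exp (-x))"
        by (intro mult_left_mono) auto
      then show ?thesis using True by (simp add: norm_mult mult_ac)
    qed simp
  qed
qed

lemma mellin_cmult: "mellin s (\<lambda>x. c * p x) = of_real c * mellin s p"
proof -
  have "mellin s (\<lambda>x. c * p x) = (LBINT x:{0<..}. of_real c * mellin_kernel s p x)"
    by (simp add: mellin_def mult_ac)
  then show ?thesis by (simp add: mellin_def)
qed

lemma mellin_diff:
  assumes "set_integrable lborel {0<..} (mellin_kernel s p)" "set_integrable lborel {0<..} (mellin_kernel s q)"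
  shows "mellin s (\<lambda>x. p x - q x) = mellin s p - mellin s q"
  unfolding mellin_def set_integral_diff(2) [OF assms, symmetric] by (simp add: algebra_simps)

lemma mellin_sum:
  assumes "\<And>i. i \<in> I \<Longrightarrow> set_integrable lborel {0<..} (mellin_kernel s (p i))"
  shows "mellin s (\<lambda>x. \<Sum>i\<in>I. p i x) = (\<Sum>i\<in>I. mellin s (p i))"
proof -
  have "mellin s (\<lambda>x. \<Sum>i\<in>I. p i x)
      = (LINT x|lborel. (\<Sum>i\<in>I. indicator {0<..} x *\<^sub>R mellin_kernel s (p i) x))"
    by (simp add: mellin_def set_lebesgue_integral_def sum_distrib_left scaleR_right.sum)
  also have "\<dots> = (\<Sum>i\<in>I. mellin s (p i))"
    unfolding mellin_def set_lebesgue_integral_def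
    by (rule Bochner_Integration.integral_sum) (use assms in \<open>simp add: set_integrable_def\<close>)
  finally show ?thesis .
qed

lemma mellin_exp_power:
  assumes "Re s > 0"
  shows "mellin s (\<lambda>x. exp (-x) ^ Suc n) = Gamma s * of_nat (Suc n) powr (- s)"
proof -
  define c :: real where "c = real (Suc n)"
  have c: "c > 0" by (simp add: c_def)
  have "Gamma s = (LINT x|lborel. indicator {0<..} x *\<^sub>R mellin_kernel s (\<lambda>x. exp (-x)) x)"
    using mellin_exp [OF assms] by (simp add: mellin_def set_lebesgue_integral_def)
  also have "\<dots> = \<bar>c\<bar> *\<^sub>R (LINT x|lborel. indicator {0<..} (0 + c * x) *\<^sub>R
      mellin_kernel s (\<lambda>x. exp (-x)) (0 + c * x))"
    using c by (intro lborel_integral_real_affine) simp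
  \<comment> \<open>The dilation by \<open>c = n + 1\<close> preserves the half-line and releases
    \<open>c\<close> to the power \<open>s - 1\<close>; the Jacobian supplies the missing factor
    \<open>c\<close>.\<close>
  also have "(\<lambda>x. indicator {0<..} (0 + c * x) *\<^sub>R mellin_kernel s (\<lambda>x. exp (-x)) (0 + c * x))
      = (\<lambda>x. of_real c powr (s - 1) * (indicator {0<..} x *\<^sub>R mellin_kernel s (\<lambda>x. exp (-x) ^ Suc n) x))"
  proof
    fix x :: real
    show "indicator {0<..} (0 + c * x) *\<^sub>R mellin_kernel s (\<lambda>x. exp (-x)) (0 + c * x)
        = of_real c powr (s - 1) * (indicator {0<..} x *\<^sub>R mellin_kernel s (\<lambda>x. exp (-x) ^ Suc n) x)"
    proof (cases "x > 0")
      case True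
      have "exp (- (c * x)) = exp (- x) ^ Suc n"
        using exp_of_nat_mult [of "Suc n" "-x"] by (simp add: c_def del: power_Suc of_nat_Suc)
      moreover have "complex_of_real (c * x) powr (s - 1) = of_real c powr (s - 1) * of_real x powr (s - 1)"
        using True c by (simp add: powr_times_real)
      ultimately show ?thesis using True c by (simp del: power_Suc)
    qed (use c in \<open>simp add: zero_less_mult_iff\<close>)
  qed
  also have "\<bar>c\<bar> *\<^sub>R (LINT x|lborel. of_real c powr (s - 1) * (indicator {0<..} x *\<^sub>R mellin_kernel s (\<lambda>x. exp (-x) ^ Suc n) x))
      = (of_real c * of_real c powr (s - 1)) * mellin s (\<lambda>x. exp (-x) ^ Suc n)"
    using c by (simp add: mellin_def set_lebesgue_integral_def scaleR_conv_of_real del: power_Suc)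
  also have "of_real c * complex_of_real c powr (s - 1) = of_real c powr s"
    using c by (simp add: powr_diff)
  finally have "Gamma s = of_nat (Suc n) powr s * mellin s (\<lambda>x. exp (-x) ^ Suc n)"
    by (simp only: c_def of_real_of_nat_eq)
  moreover have "complex_of_nat (Suc n) powr s \<noteq> 0"
    by (simp del: of_nat_Suc)
  ultimately show ?thesis
    by (simp add: powr_minus field_simps del: power_Suc of_nat_Suc)
qed

subsection \<open>Differences of the Dirichlet monomials\<close>

definition dpow :: "complex \<Rightarrow> nat \<Rightarrow> complex" where
  "dpow s j = of_nat (Suc j) powr (- s)"

lemma dpow_diff_1: "dpow (s - 1) j = of_nat (Suc j) * dpow s j"
proof -
  have "dpow (s - 1) j = of_nat (Suc j) powr (1 + (- s))" by (simp add: dpow_def)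
  also have "\<dots> = of_nat (Suc j) * dpow s j"
    unfolding dpow_def powr_add by (simp del: of_nat_Suc)
  finally show ?thesis .
qed

lemma dpow_diff_of_nat: "dpow (s - of_nat l) j = of_nat (Suc j) ^ l * dpow s j"
proof (induction l)
  case (Suc l)
  have "dpow (s - of_nat (Suc l)) j = dpow ((s - of_nat l) - 1) j" by (simp add: algebra_simps)
  then show ?case unfolding dpow_diff_1 Suc.IH by (simp only: power_Suc mult_ac)
qed simp

lemma dpow_add: "dpow (s + t) j = dpow s j * dpow t j"
  by (simp add: dpow_def powr_add [symmetric])

lemma exp_diff_power_bounded:
  fixes x :: real
  assumes "x > 0"
  shows "\<bar>exp (-x) ^ Suc m * (1 - exp (-x)) ^ i\<bar> \<le> 1 * exp (-x)"
proof -
  have "exp (-x) ^ m \<le> 1" "(1 - exp (-x)) ^ i \<le> 1"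
    using assms by (auto intro!: power_le_one)
  then have "exp (-x) ^ m * (1 - exp (-x)) ^ i \<le> 1"
    using assms by (intro mult_le_one) auto
  then have "exp (-x) * (exp (-x) ^ m * (1 - exp (-x)) ^ i) \<le> exp (-x) * 1"
    by (intro mult_left_mono) auto
  moreover have "0 \<le> exp (-x) ^ Suc m * (1 - exp (-x)) ^ i"
    using assms by auto
  ultimately show ?thesis by (simp add: mult_ac)
qed

lemma mellin_diff_power_integrable:
  assumes "Re s > 0"
  shows "set_integrable lborel {0<..} (mellin_kernel s (\<lambda>x. exp (-x) ^ Suc m * (1 - exp (-x)) ^ i))"
  by (rule mellin_integrable [OF assms _ exp_diff_power_bounded]) (auto intro!: continuous_intros)

text \<open>Expanding by \<open>fdiff_power\<close> at \<open>z = exp (-x)\<close> leaves pure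
  exponentials, each of which transforms to \<open>Gamma s\<close> times a value of
  \<open>dpow s\<close>.\<close>

lemma mellin_diff_power:
  assumes "Re s > 0"
  shows "mellin s (\<lambda>x. exp (-x) ^ Suc m * (1 - exp (-x)) ^ i) = Gamma s * fdiff (dpow s) i m"
proof -
  have int: "set_integrable lborel {0<..} (mellin_kernel s (\<lambda>x. c * exp (-x) ^ Suc n))" for c n
    using set_integrable_mult_right [of "of_real c" lborel "{0<..}"
        "mellin_kernel s (\<lambda>x. exp (-x) ^ Suc n * (1 - exp (-x)) ^ 0)", OF mellin_diff_power_integrable [OF assms]]
    by (simp add: mult_ac)
  have "exp (-x) ^ Suc m * (1 - exp (-x)) ^ i
      = (\<Sum>j\<le>i. ((-1) ^ j * real (i choose j)) * exp (-x) ^ Suc (m + j))" for x :: real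
    using fdiff_power [of "exp (-x)" i m, symmetric]
    by (simp add: fdiff_def sum_distrib_left mult_ac)
  then have "mellin s (\<lambda>x. exp (-x) ^ Suc m * (1 - exp (-x)) ^ i)
      = mellin s (\<lambda>x. \<Sum>j\<le>i. ((-1) ^ j * real (i choose j)) * exp (-x) ^ Suc (m + j))"
    by presburger
  also have "\<dots> = (\<Sum>j\<le>i. mellin s (\<lambda>x. ((-1) ^ j * real (i choose j)) * exp (-x) ^ Suc (m + j)))"
    by (rule mellin_sum [OF int])
  also have "\<dots> = (\<Sum>j\<le>i. of_real ((-1) ^ j * real (i choose j)) * (Gamma s * dpow s (m + j)))"
    by (simp only: mellin_cmult mellin_exp_power [OF assms] dpow_def)
  also have "\<dots> = Gamma s * fdiff (dpow s) i m"
    by (simp add: fdiff_def sum_distrib_left mult_ac)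
  finally show ?thesis .
qed

lemma Gamma_nonzero_Re_pos: "Re s > 0 \<Longrightarrow> Gamma s \<noteq> 0"
  by (auto simp: Gamma_eq_zero_iff elim!: nonpos_Ints_cases)

text \<open>For \<open>x > 0\<close> the modulus of \<open>x\<close> to the power
  \<open>s - 1\<close> depends only on \<open>Re s\<close>, so the triangle inequality for integrals
  yields the transform at a real exponent.\<close>

lemma norm_mellin_le:
  assumes "set_integrable lborel {0<..} (mellin_kernel (of_real (Re s)) p)" "\<And>x. x > 0 \<Longrightarrow> p x \<ge> 0"
  shows "norm (mellin s p) \<le> Re (mellin (of_real (Re s)) p)"
proof -
  have "norm (mellin s p) \<le> (LINT x|lborel. norm (indicator {0<..} x *\<^sub>R mellin_kernel s p x))"
    unfolding mellin_def set_lebesgue_integral_def by (rule integral_norm_bound)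
  also have "(\<lambda>x. norm (indicator {0<..} x *\<^sub>R mellin_kernel s p x))
      = (\<lambda>x. Re (indicator {0<..} x *\<^sub>R mellin_kernel (of_real (Re s)) p x))"
  proof
    fix x :: real
    show "norm (indicator {0<..} x *\<^sub>R mellin_kernel s p x)
        = Re (indicator {0<..} x *\<^sub>R mellin_kernel (of_real (Re s)) p x)"
    proof (cases "x > 0")
      case True
      have "complex_of_real x powr (of_real (Re s) - 1) = of_real (x powr (Re s - 1))"
        using True by (simp add: powr_of_real [symmetric])
      then show ?thesis
        using True assms(2) [of x] by (simp add: norm_mult norm_powr_real_powr)
    qed simp
  qed
  also have "(LINT x|lborel. \<dots> x) = Re (mellin (of_real (Re s)) p)"
    using assms(1) unfolding mellin_def set_lebesgue_integral_def set_integrable_def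
    by (rule integral_Re)
  finally show ?thesis .
qed

text \<open>The weights are those of the Leibniz rule for \<open>fdiff\<close>. Under the Mellin transform the sum
  becomes the binomial expansion of \<open>(z + (1 - z))^k\<close> with \<open>z = exp (-x)\<close>, so no power of 2 is
  lost although all cancellation between different \<open>m\<close> is given away.\<close>

definition diff_norm :: "complex \<Rightarrow> nat \<Rightarrow> real" where
  "diff_norm s k = (\<Sum>m\<le>k. real (k choose m) * norm (fdiff (dpow s) (k - m) m))"

lemma norm_fdiff_dpow_le: "norm (fdiff (dpow s) k 0) \<le> diff_norm s k"
  using member_le_sum [of 0 "{..k}" "\<lambda>m. real (k choose m) * norm (fdiff (dpow s) (k - m) m)"]
  by (simp add: diff_norm_def)

text \<open>At the real exponent \<open>Re s\<close> all integrands are nonnegative and add up to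
  \<open>exp (-x)\<close>. Hence the bound does not depend on \<open>k\<close>.\<close>

lemma diff_norm_le_Gamma:
  assumes "Re s > 0"
  shows "diff_norm s k \<le> Gamma (Re s) / norm (Gamma s)"
proof -
  define \<sigma> where "\<sigma> = complex_of_real (Re s)"
  define p where "p = (\<lambda>m (x::real). exp (-x) ^ Suc m * (1 - exp (-x)) ^ (k - m))"
  have \<sigma>: "Re \<sigma> > 0" using assms by (simp add: \<sigma>_def)
  have int: "set_integrable lborel {0<..} (mellin_kernel \<sigma> (p m))" for m
    unfolding p_def by (rule mellin_diff_power_integrable [OF \<sigma>])
  have int': "set_integrable lborel {0<..} (mellin_kernel \<sigma> (\<lambda>x. real (k choose m) * p m x))" for m
    using set_integrable_mult_right [of "of_nat (k choose m)", OF int [of m]] by (simp add: mult_ac)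
  have G: "Gamma s \<noteq> 0"
    by (rule Gamma_nonzero_Re_pos [OF assms])
  have "norm (Gamma s) * diff_norm s k = (\<Sum>m\<le>k. real (k choose m) * norm (mellin s (p m)))"
    by (simp only: p_def mellin_diff_power [OF assms] diff_norm_def sum_distrib_left norm_mult mult_ac)
  also have "\<dots> \<le> (\<Sum>m\<le>k. real (k choose m) * Re (mellin \<sigma> (p m)))"
    unfolding \<sigma>_def
    by (intro sum_mono mult_left_mono norm_mellin_le int [unfolded \<sigma>_def]) (auto simp: p_def)
  also have "\<dots> = Re (\<Sum>m\<le>k. mellin \<sigma> (\<lambda>x. real (k choose m) * p m x))"
    by (simp add: mellin_cmult)
  also have "(\<Sum>m\<le>k. mellin \<sigma> (\<lambda>x. real (k choose m) * p m x)) = mellin \<sigma> (\<lambda>x. \<Sum>m\<le>k. real (k choose m) * p m x)"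
    by (rule mellin_sum [OF int', symmetric])
  also have "(\<lambda>x. \<Sum>m\<le>k. real (k choose m) * p m x) = (\<lambda>x. exp (-x))"
  proof
    fix x :: real
    have "(\<Sum>m\<le>k. real (k choose m) * p m x)
        = exp (-x) * (\<Sum>m\<le>k. real (k choose m) * exp (-x) ^ m * (1 - exp (-x)) ^ (k - m))"
      by (simp add: p_def sum_distrib_left mult_ac)
    also have "\<dots> = exp (-x) * (exp (-x) + (1 - exp (-x))) ^ k"
      by (simp only: binomial_ring)
    finally show "(\<Sum>m\<le>k. real (k choose m) * p m x) = exp (-x)" by simp
  qed
  also have "Re (mellin \<sigma> (\<lambda>x. exp (-x))) = Gamma (Re s)"
    unfolding mellin_exp [OF \<sigma>] by (simp add: \<sigma>_def Gamma_complex_of_real)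
  finally show ?thesis using G by (simp add: field_simps)
qed

text \<open>By \<open>fdiff_mult_Suc\<close> every term splits in two. Both parts are multiples of
  terms of \<open>diff_norm s k\<close>, with factors at most \<open>k + 1\<close> and
  \<open>k\<close>.\<close>

lemma diff_norm_diff_1: "diff_norm (s - 1) k \<le> (2 * real k + 1) * diff_norm s k"
proof -
  define A where "A = (\<lambda>m. real (k choose m) * norm (fdiff (dpow s) (k - m) m))"
  have A0: "A m \<ge> 0" for m by (simp add: A_def)
  have eq: "dpow (s - 1) = (\<lambda>j. of_nat (Suc j) * dpow s j)"
    by (rule ext) (rule dpow_diff_1)
  have "diff_norm (s - 1) k \<le> (\<Sum>m\<le>k. real (Suc m) * A m + (if m < k then real (Suc m) * A (Suc m) else 0))"
    unfolding diff_norm_def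
  proof (rule sum_mono)
    fix m assume m: "m \<in> {..k}"
    have "norm (fdiff (dpow (s - 1)) (k - m) m)
        \<le> real (Suc m) * norm (fdiff (dpow s) (k - m) m)
          + real (k - m) * norm (fdiff (dpow s) (k - m - 1) (Suc m))"
      unfolding eq fdiff_mult_Suc
      by (rule order.trans [OF norm_triangle_ineq4]) (simp only: norm_mult norm_of_nat order.refl)
    then have "real (k choose m) * norm (fdiff (dpow (s - 1)) (k - m) m)
        \<le> real (Suc m) * A m + real ((k - m) * (k choose m)) * norm (fdiff (dpow s) (k - m - 1) (Suc m))"
      unfolding A_def by (drule_tac mult_left_mono [where c = "real (k choose m)"]) (auto simp: distrib_left mult_ac simp del: of_nat_Suc of_nat_diff)
    also have "real ((k - m) * (k choose m)) * norm (fdiff (dpow s) (k - m - 1) (Suc m))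
        = (if m < k then real (Suc m) * A (Suc m) else 0)"
    proof (cases "m < k")
      case True
      \<comment> \<open>Absorption converts the weight at \<open>m\<close> into the one that
        \<open>diff_norm\<close> assigns to \<open>Suc m\<close>.\<close>
      then have "(k - m) * (k choose m) = Suc m * (k choose Suc m)"
        using binomial_absorb_comp [of k m] binomial_absorption [of m k] by simp
      then have "real ((k - m) * (k choose m)) = real (Suc m) * real (k choose Suc m)"
        by (simp only: of_nat_mult)
      then show ?thesis using True by (simp add: A_def del: of_nat_Suc of_nat_mult)
    qed (use m in auto)
    finally show "real (k choose m) * norm (fdiff (dpow (s - 1)) (k - m) m)
        \<le> real (Suc m) * A m + (if m < k then real (Suc m) * A (Suc m) else 0)" .
  qed
  also have "\<dots> = (\<Sum>m\<le>k. real (Suc m) * A m) + (\<Sum>m<k. real (Suc m) * A (Suc m))"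
    by (subst sum.distrib, intro arg_cong2 [where f = "(+)"] refl sum.mono_neutral_cong_right) auto
  also have "\<dots> \<le> (\<Sum>m\<le>k. real (Suc k) * A m) + (\<Sum>m<k. real k * A (Suc m))"
    by (intro add_mono sum_mono mult_right_mono A0) auto
  also have "(\<Sum>m<k. real k * A (Suc m)) \<le> (\<Sum>m\<le>k. real k * A m)"
    unfolding sum_distrib_left [symmetric] sum.atMost_shift [of A] using A0 [of 0]
    by (intro mult_left_mono) auto
  also have "(\<Sum>m\<le>k. real (Suc k) * A m) + (\<Sum>m\<le>k. real k * A m) = (2 * real k + 1) * diff_norm s k"
    unfolding diff_norm_def A_def [symmetric] sum_distrib_left [symmetric] by (simp add: algebra_simps)
  finally show ?thesis by simp
qed

text \<open>Each of the \<open>q\<close> unit shifts towards the half-plane \<open>Re s > 0\<close>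
  costs one factor \<open>2 k + 1\<close>.\<close>

lemma diff_norm_poly_bound:
  assumes "Re s > - real q"
  shows "diff_norm s k \<le> (2 * real k + 1) ^ q * (Gamma (Re s + real q) / norm (Gamma (s + of_nat q)))"
  using assms
proof (induction q arbitrary: s)
  case 0
  then show ?case using diff_norm_le_Gamma [of s k] by simp
next
  case (Suc q)
  have "diff_norm s k \<le> (2 * real k + 1) * diff_norm (s + 1) k"
    using diff_norm_diff_1 [of "s + 1" k] by simp
  also have "\<dots> \<le> (2 * real k + 1) * ((2 * real k + 1) ^ q *
      (Gamma (Re (s + 1) + real q) / norm (Gamma ((s + 1) + of_nat q))))"
    using Suc.prems by (intro mult_left_mono Suc.IH) auto
  finally show ?case by (simp add: add_ac)
qed

text \<open>For a fixed \<open>s\<close> the Gamma quotient may be hidden in \<open>K\<close>; the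
  holomorphy proof needs its explicit form to obtain uniformity in \<open>s\<close>.\<close>

lemma diff_norm_poly_bound_ex: "\<exists>K q. K \<ge> 0 \<and> (\<forall>k. diff_norm s k \<le> K * (2 * real k + 1) ^ q)"
proof -
  obtain q :: nat where "- Re s < real q" using reals_Archimedean2 by blast
  then have q: "Re s > - real q" by simp
  have "Gamma (Re s + real q) / norm (Gamma (s + of_nat q)) \<ge> 0"
    using q by (intro divide_nonneg_nonneg order.strict_implies_order [OF Gamma_real_pos]) auto
  with diff_norm_poly_bound [OF q] show ?thesis
    by (metis mult.commute)
qed

lemma summable_poly_over_power2: "summable (\<lambda>k. (2 * real k + 1) ^ q / 2 ^ Suc k)"
proof (rule summable_comparison_test_bigo)
  show "summable (\<lambda>k. norm (1 / real k ^ 2))"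
    using inverse_power_summable [of 2, where 'a = real] by (simp add: field_simps)
  show "(\<lambda>k. (2 * real k + 1) ^ q / 2 ^ Suc k) \<in> O(\<lambda>k. 1 / real k ^ 2)"
    by real_asymp
qed

subsection \<open>The Hasse series of the eta function\<close>

text \<open>This is Euler's transformation of the alternating series of
  \<open>dpow s\<close>.\<close>

definition hasse_eta :: "complex \<Rightarrow> complex" where
  "hasse_eta s = (\<Sum>k. fdiff (dpow s) k 0 / 2 ^ Suc k)"

text \<open>The Weierstrass test on closed unit balls: one \<open>q\<close> serves the whole ball,
  and the Gamma quotient is bounded there by compactness.\<close>

lemma hasse_eta_holomorphic: "hasse_eta holomorphic_on UNIV"
proof (rule holomorphic_uniform_sequence [of UNIV "\<lambda>n s. \<Sum>k<n. fdiff (dpow s) k 0 / 2 ^ Suc k"])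
  show "(\<lambda>s. \<Sum>k<n. fdiff (dpow s) k 0 / 2 ^ Suc k) holomorphic_on UNIV" for n
    unfolding fdiff_def dpow_def by (intro holomorphic_intros) (auto simp del: of_nat_Suc)
  fix x :: complex
  \<comment> \<open>The summand 1 is the radius of the ball, so that \<open>Re s + q > 0\<close> for
    every \<open>s\<close> in it.\<close>
  obtain q :: nat where q: "1 - Re x < real q" using reals_Archimedean2 by blast
  have *: "Re s + real q > 0" if "s \<in> cball x 1" for s
    using that q abs_Re_le_cmod [of "x - s"] by (auto simp: dist_norm)
  have nz: "Gamma (s + of_nat q) \<noteq> 0" if "s \<in> cball x 1" for s
    using * [OF that] by (intro Gamma_nonzero_Re_pos) simp
  have "continuous_on (cball x 1) (\<lambda>s. Gamma (Re s + real q) / norm (Gamma (s + of_nat q)))"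
  proof (intro continuous_at_imp_continuous_on ballI isCont_divide isCont_norm isCont_Gamma isCont_add isCont_Re
      continuous_ident continuous_const)
    fix s assume s: "s \<in> cball x 1"
    show "Re s + real q \<notin> \<int>\<^sub>\<le>\<^sub>0"
      using * [OF s] by (auto elim!: nonpos_Ints_cases)
    show "s + of_nat q \<notin> \<int>\<^sub>\<le>\<^sub>0"
      using nz [OF s] by (simp add: Gamma_eq_zero_iff)
    show "norm (Gamma (s + of_nat q)) \<noteq> 0"
      using nz [OF s] by simp
  qed
  then have "compact ((\<lambda>s. Gamma (Re s + real q) / norm (Gamma (s + of_nat q))) ` cball x 1)"
    by (rule compact_continuous_image) simp
  then have "bounded ((\<lambda>s. Gamma (Re s + real q) / norm (Gamma (s + of_nat q))) ` cball x 1)"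
    by (rule compact_imp_bounded)
  then obtain M where M: "\<And>s. s \<in> cball x 1 \<Longrightarrow> Gamma (Re s + real q) / norm (Gamma (s + of_nat q)) \<le> M"
    unfolding bounded_iff by (metis (no_types, lifting) abs_ge_self imageI order_trans real_norm_def)
  have "uniform_limit (cball x 1) (\<lambda>n s. \<Sum>k<n. fdiff (dpow s) k 0 / 2 ^ Suc k) hasse_eta sequentially"
    unfolding hasse_eta_def
  proof (rule Weierstrass_m_test)
    fix k s assume s: "s \<in> cball x 1"
    have "norm (fdiff (dpow s) k 0) \<le> diff_norm s k" by (rule norm_fdiff_dpow_le)
    also have "\<dots> \<le> (2 * real k + 1) ^ q * (Gamma (Re s + real q) / norm (Gamma (s + of_nat q)))"
      using * [OF s] by (intro diff_norm_poly_bound) simp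
    also have "\<dots> \<le> (2 * real k + 1) ^ q * M"
      by (intro mult_left_mono M s) simp
    finally show "norm (fdiff (dpow s) k 0 / 2 ^ Suc k) \<le> M * ((2 * real k + 1) ^ q / 2 ^ Suc k)"
      by (simp add: norm_divide norm_mult norm_power field_simps)
  next
    show "summable (\<lambda>k. M * ((2 * real k + 1) ^ q / 2 ^ Suc k))"
      by (intro summable_mult summable_poly_over_power2)
  qed
  then show "\<exists>d>0. cball x d \<subseteq> UNIV \<and>
      uniform_limit (cball x d) (\<lambda>n s. \<Sum>k<n. fdiff (dpow s) k 0 / 2 ^ Suc k) hasse_eta sequentially"
    by (intro exI [of _ 1]) auto
qed auto

lemma summable_fdiff_dpow: "summable (\<lambda>k. fdiff (dpow s) k 0 / 2 ^ Suc k)"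
proof -
  obtain K q where K: "\<And>k. diff_norm s k \<le> K * (2 * real k + 1) ^ q"
    using diff_norm_poly_bound_ex [of s] by blast
  show ?thesis
  proof (rule summable_comparison_test')
    show "summable (\<lambda>k. K * ((2 * real k + 1) ^ q / 2 ^ Suc k))"
      by (intro summable_mult summable_poly_over_power2)
    fix k :: nat assume "k \<ge> 0"
    show "norm (fdiff (dpow s) k 0 / 2 ^ Suc k) \<le> K * ((2 * real k + 1) ^ q / 2 ^ Suc k)"
      using order.trans [OF norm_fdiff_dpow_le K, of k]
      by (simp add: norm_divide norm_mult norm_power field_simps)
  qed
qed

section \<open>Summation under the Mellin transform and identification with eta\<close>

lemma negative_binomial_sums:
  fixes y :: real
  assumes "\<bar>y\<bar> < 1"
  shows "(\<lambda>i. real ((i + m) choose m) * y ^ i) sums (1 / (1 - y) ^ Suc m)"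
proof -
  \<comment> \<open>Newton's series at exponent \<open>- (m + 1)\<close>; negating the upper index
    makes its coefficients ordinary binomials.\<close>
  have "(\<lambda>i. (- real (Suc m) gchoose i) * (- y) ^ i) sums (1 + - y) powr (- real (Suc m))"
    by (rule gen_binomial_real) (use assms in simp)
  moreover have "(- real (Suc m) gchoose i) * (- y) ^ i = real ((i + m) choose m) * y ^ i" for i
  proof -
    have "(- real (Suc m) gchoose i) = (-1) ^ i * (real (i + m) gchoose i)"
      by (subst gbinomial_minus) (simp add: add_ac)
    also have "real (i + m) gchoose i = real ((i + m) choose m)"
      using binomial_symmetric [of m "i + m"] by (simp add: binomial_gbinomial [symmetric] del: of_nat_add)
    finally have "(- real (Suc m) gchoose i) * (- y) ^ i = real ((i + m) choose m) * ((-1) ^ i * (- y) ^ i)"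
      by simp
    then show ?thesis by (simp add: power_mult_distrib [symmetric])
  qed
  moreover have "(1 + - y) powr (- real (Suc m)) = 1 / (1 - y) ^ Suc m"
    using assms by (simp add: powr_minus powr_realpow field_simps del: power_Suc of_nat_Suc)
  ultimately show ?thesis by simp
qed

text \<open>With \<open>k = i + m\<close> this is the negative binomial series at
  \<open>y = (1 - z) / 2\<close>, where \<open>1 - y = (1 + z) / 2\<close>. The terms with
  \<open>k < m\<close> vanish.\<close>

lemma binomial_kernel_sums:
  fixes z :: real
  assumes "0 < z" "z < 1"
  shows "(\<lambda>k. real (k choose m) / 2 ^ Suc k * (z ^ Suc m * (1 - z) ^ (k - m))) sums (z / (1 + z)) ^ Suc m"
proof -
  have "(\<lambda>i. (z / 2) ^ Suc m * (real ((i + m) choose m) * ((1 - z) / 2) ^ i))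
      sums ((z / 2) ^ Suc m * (1 / (1 - (1 - z) / 2) ^ Suc m))"
    by (intro sums_mult negative_binomial_sums) (use assms in simp)
  moreover have "(z / 2) ^ Suc m * (1 / (1 - (1 - z) / 2) ^ Suc m) = (z / (1 + z)) ^ Suc m"
  proof -
    have *: "1 - (1 - z) / 2 = (1 + z) / 2" by (simp add: field_simps)
    show ?thesis unfolding * by (simp add: power_divide del: power_Suc)
  qed
  moreover have "(z / 2) ^ Suc m * (real ((i + m) choose m) * ((1 - z) / 2) ^ i)
      = real ((i + m) choose m) / 2 ^ Suc (i + m) * (z ^ Suc m * (1 - z) ^ (i + m - m))" for i
    by (simp add: power_divide power_add mult_ac)
  ultimately have "(\<lambda>i. real ((i + m) choose m) / 2 ^ Suc (i + m) * (z ^ Suc m * (1 - z) ^ (i + m - m)))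
      sums (z / (1 + z)) ^ Suc m"
    by (simp only:)
  then show ?thesis
    by (rule sums_zero_iff_shift [THEN iffD1, rotated]) (simp add: binomial_eq_0)
qed

lemma logistic_power_le:
  fixes x :: real
  shows "(exp (-x) / (1 + exp (-x))) ^ Suc m \<le> exp (-x)"
proof -
  have pos: "1 + exp (-x) > 0" by (simp add: add_pos_pos)
  have "exp (-x) / (1 + exp (-x)) \<le> exp (-x)"
    by (simp add: pos divide_le_eq algebra_simps)
  moreover have "(exp (-x) / (1 + exp (-x))) ^ m \<le> 1"
    by (intro power_le_one divide_nonneg_pos pos) (auto simp: pos divide_le_eq)
  ultimately have "exp (-x) / (1 + exp (-x)) * (exp (-x) / (1 + exp (-x))) ^ m \<le> exp (-x) * 1"
    by (intro mult_mono divide_nonneg_pos pos zero_le_power) auto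
  then show ?thesis by simp
qed

text \<open>The Mellin transform of \<open>binomial_kernel_sums\<close> at
  \<open>z = exp (-x)\<close>, taken termwise. The kernel is nonnegative, so its partial sums are
  dominated by the full sum, hence by \<open>exp (-x)\<close>.\<close>

lemma fdiff_dpow_sums_mellin:
  assumes "Re s > 0"
  shows "(\<lambda>k. of_nat (k choose m) / 2 ^ Suc k * fdiff (dpow s) (k - m) m)
    sums (mellin s (\<lambda>x. (exp (-x) / (1 + exp (-x))) ^ Suc m) / Gamma s)"
proof -
  define p where "p = (\<lambda>k (x::real). real (k choose m) / 2 ^ Suc k * (exp (-x) ^ Suc m * (1 - exp (-x)) ^ (k - m)))"
  have G: "Gamma s \<noteq> 0"
    by (rule Gamma_nonzero_Re_pos [OF assms])
  have pos: "1 + exp (-x) > 0" for x :: real by (simp add: add_pos_pos)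
  have sums: "(\<lambda>k. p k x) sums (exp (-x) / (1 + exp (-x))) ^ Suc m" if "x > 0" for x
    unfolding p_def by (rule binomial_kernel_sums) (use that in auto)
  have p0: "p k x \<ge> 0" if "x > 0" for k x using that by (simp add: p_def)
  have "(\<lambda>N. mellin s (\<lambda>x. \<Sum>k<N. p k x)) \<longlonglongrightarrow> mellin s (\<lambda>x. (exp (-x) / (1 + exp (-x))) ^ Suc m)"
  proof (rule mellin_tendsto [OF assms, where C = 1])
    show "continuous_on {0<..} (\<lambda>x. \<Sum>k<N. p k x)" for N
      unfolding p_def by (intro continuous_intros)
    show "continuous_on {0<..} (\<lambda>x::real. (exp (-x) / (1 + exp (-x))) ^ Suc m)"
      by (intro continuous_intros) (metis pos less_irrefl)
    show "\<bar>\<Sum>k<N. p k x\<bar> \<le> 1 * exp (-x)" if "x > 0" for N x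
    proof -
      have "(\<Sum>k<N. p k x) \<le> (exp (-x) / (1 + exp (-x))) ^ Suc m"
        using sum_le_suminf [OF sums_summable [OF sums [OF that]], of "{..<N}"] p0 [OF that]
          sums_unique [OF sums [OF that]] by simp
      with logistic_power_le [of x m] show ?thesis using p0 [OF that] by (simp add: sum_nonneg del: power_Suc)
    qed
    show "(\<lambda>N. \<Sum>k<N. p k x) \<longlonglongrightarrow> (exp (-x) / (1 + exp (-x))) ^ Suc m" if "x > 0" for x
      using sums [OF that] by (simp only: sums_def)
  qed
  moreover have "mellin s (\<lambda>x. \<Sum>k<N. p k x)
      = Gamma s * (\<Sum>k<N. of_nat (k choose m) / 2 ^ Suc k * fdiff (dpow s) (k - m) m)" for N
  proof -
    have "set_integrable lborel {0<..} (mellin_kernel s (p k))" for k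
      using set_integrable_mult_right [of "of_nat (k choose m) / 2 ^ Suc k",
          OF mellin_diff_power_integrable [OF assms, of m "k - m"]]
      unfolding p_def by (simp add: mult_ac)
    then have "mellin s (\<lambda>x. \<Sum>k<N. p k x) = (\<Sum>k<N. mellin s (p k))"
      by (intro mellin_sum)
    also have "\<dots> = (\<Sum>k<N. of_real (real (k choose m) / 2 ^ Suc k) * (Gamma s * fdiff (dpow s) (k - m) m))"
      unfolding p_def by (simp only: mellin_cmult mellin_diff_power [OF assms])
    finally show ?thesis by (simp add: sum_distrib_left mult_ac)
  qed
  ultimately have "(\<lambda>N. Gamma s * (\<Sum>k<N. of_nat (k choose m) / 2 ^ Suc k * fdiff (dpow s) (k - m) m) / Gamma s)
      \<longlonglongrightarrow> mellin s (\<lambda>x. (exp (-x) / (1 + exp (-x))) ^ Suc m) / Gamma s"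
    by (intro tendsto_divide tendsto_const G) simp
  then show ?thesis using G by (simp add: sums_def)
qed

text \<open>The partial sums of the integrand are geometric and bounded uniformly in
  \<open>N\<close>, so dominated convergence also covers \<open>0 < Re s \<le> 1\<close>, where the
  Dirichlet series is not absolutely convergent.\<close>

lemma alternating_dpow_sums_mellin:
  assumes "Re s > 0"
  shows "(\<lambda>n. (-1) ^ n * dpow s n) sums (mellin s (\<lambda>x. exp (-x) / (1 + exp (-x))) / Gamma s)"
proof -
  define p where "p = (\<lambda>n (x::real). (-1) ^ n * exp (-x) ^ Suc n)"
  have G: "Gamma s \<noteq> 0"
    by (rule Gamma_nonzero_Re_pos [OF assms])
  have pos: "1 + exp (-x) > 0" for x :: real by (simp add: add_pos_pos)
  have partial: "(\<Sum>n<N. p n x) = exp (-x) * ((1 - (- exp (-x)) ^ N) / (1 + exp (-x)))" for N x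
  proof -
    have "(\<Sum>n<N. p n x) = exp (-x) * (\<Sum>n<N. (- exp (-x)) ^ n)"
      unfolding p_def sum_distrib_left by (intro sum.cong) (auto simp: power_minus [of "exp (-x)"])
    also have "(\<Sum>n<N. (- exp (-x)) ^ n) = (1 - (- exp (-x)) ^ N) / (1 + exp (-x))"
      using pos [of x] by (subst sum_gp_strict) auto
    finally show ?thesis .
  qed
  have "(\<lambda>N. mellin s (\<lambda>x. \<Sum>n<N. p n x)) \<longlonglongrightarrow> mellin s (\<lambda>x. exp (-x) / (1 + exp (-x)))"
  \<comment> \<open>The numerator \<open>1 - (- exp (-x)) ^ N\<close> has modulus at most 2, and the
    denominator is at least 1.\<close>
  proof (rule mellin_tendsto [OF assms, where C = 2])
    show "continuous_on {0<..} (\<lambda>x. \<Sum>n<N. p n x)" for N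
      unfolding p_def by (intro continuous_intros)
    show "continuous_on {0<..} (\<lambda>x::real. exp (-x) / (1 + exp (-x)))"
      by (intro continuous_intros) (metis pos less_irrefl)
    show "\<bar>\<Sum>n<N. p n x\<bar> \<le> 2 * exp (-x)" if "x > 0" for N x
    proof -
      have "\<bar>(- exp (-x)) ^ N\<bar> \<le> 1"
        using that by (auto simp: power_abs intro!: power_le_one)
      then have "\<bar>1 - (- exp (-x)) ^ N\<bar> \<le> 2" by linarith
      also have "\<dots> \<le> 2 * (1 + exp (-x))" by simp
      finally have "\<bar>(1 - (- exp (-x)) ^ N) / (1 + exp (-x))\<bar> \<le> 2"
        using pos [of x] by (simp add: abs_divide divide_le_eq)
      then have "exp (-x) * \<bar>(1 - (- exp (-x)) ^ N) / (1 + exp (-x))\<bar> \<le> exp (-x) * 2"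
        by (intro mult_left_mono) auto
      then show ?thesis by (simp only: partial abs_mult abs_exp_cancel mult.commute)
    qed
    show "(\<lambda>N. \<Sum>n<N. p n x) \<longlonglongrightarrow> exp (-x) / (1 + exp (-x))" if "x > 0" for x
    proof -
      have "(\<lambda>N. (- exp (-x)) ^ N) \<longlonglongrightarrow> 0"
        using that by (intro LIMSEQ_power_zero) auto
      then have "(\<lambda>N. exp (-x) * ((1 - (- exp (-x)) ^ N) / (1 + exp (-x))))
          \<longlonglongrightarrow> exp (-x) * ((1 - 0) / (1 + exp (-x)))"
        using pos [of x] by (intro tendsto_mult tendsto_divide tendsto_diff tendsto_const) auto
      then show ?thesis by (simp add: partial)
    qed
  qed
  moreover have "mellin s (\<lambda>x. \<Sum>n<N. p n x) = Gamma s * (\<Sum>n<N. (-1) ^ n * dpow s n)" for N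
  proof -
    have "set_integrable lborel {0<..} (mellin_kernel s (p n))" for n
      using set_integrable_mult_right [of "(-1) ^ n",
          OF mellin_diff_power_integrable [OF assms, of n 0]]
      unfolding p_def by (simp add: mult_ac)
    then have "mellin s (\<lambda>x. \<Sum>n<N. p n x) = (\<Sum>n<N. mellin s (p n))"
      by (intro mellin_sum)
    also have "\<dots> = (\<Sum>n<N. of_real ((-1) ^ n) * (Gamma s * dpow s n))"
      unfolding p_def by (simp only: mellin_cmult mellin_exp_power [OF assms] dpow_def)
    finally show ?thesis by (simp add: sum_distrib_left mult_ac)
  qed
  ultimately have "(\<lambda>N. Gamma s * (\<Sum>n<N. (-1) ^ n * dpow s n) / Gamma s)
      \<longlonglongrightarrow> mellin s (\<lambda>x. exp (-x) / (1 + exp (-x))) / Gamma s"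
    by (intro tendsto_divide tendsto_const G) simp
  then show ?thesis using G by (simp add: sums_def)
qed

text \<open>Both series are the same Mellin integral; the Hasse side is the case
  \<open>m = 0\<close> of \<open>fdiff_dpow_sums_mellin\<close>.\<close>

lemma hasse_eta_eq_series:
  assumes "Re s > 0"
  shows "hasse_eta s = (\<Sum>n. (-1) ^ n / of_nat (n + 1) powr s)"
proof -
  have "hasse_eta s = mellin s (\<lambda>x. exp (-x) / (1 + exp (-x))) / Gamma s"
    using sums_unique [OF fdiff_dpow_sums_mellin [OF assms, of 0]] by (simp add: hasse_eta_def)
  also have "\<dots> = (\<Sum>n. (-1) ^ n * dpow s n)"
    by (rule sums_unique [OF alternating_dpow_sums_mellin [OF assms]])
  finally show ?thesis by (simp add: dpow_def powr_minus field_simps)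
qed

text \<open>\<open>hasse_eta\<close> supplies existence for the definite description; the identity
  theorem, applied from the half-plane \<open>Re s > 0\<close>, supplies uniqueness.\<close>

lemma eta_eq_hasse_eta: "eta = hasse_eta"
  unfolding eta_def
proof (rule the_equality)
  fix f :: "complex \<Rightarrow> complex"
  assume f: "f holomorphic_on UNIV \<and>
     (\<forall>s. Re s > 0 \<longrightarrow> f s = (\<Sum>n. (-1) ^ n / (of_nat (n + 1)) powr s))"
  show "f = hasse_eta"
  proof
    fix s
    show "f s = hasse_eta s"
    proof (rule analytic_continuation_open [of "{s. Re s > 0}" UNIV f hasse_eta])
      show "{s. Re s > 0} \<noteq> {}" using Re_complex_of_real [of 1] by (metis empty_Collect_eq zero_less_one)
    qed (use f hasse_eta_eq_series hasse_eta_holomorphic in \<open>auto simp: open_halfspace_Re_gt\<close>)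
  qed
qed (use hasse_eta_eq_series hasse_eta_holomorphic in auto)

lemma eta_sums: "(\<lambda>k. fdiff (dpow s) k 0 / 2 ^ Suc k) sums eta s"
  unfolding eta_eq_hasse_eta hasse_eta_def by (rule summable_sums [OF summable_fdiff_dpow])

subsection \<open>The Newton expansion\<close>

text \<open>The Stirling form is taken as the definition because it makes sense for every
  \<open>s\<close>, whereas the integral form is available only for
  \<open>Re s > -1\<close>.\<close>

definition newton_coeff :: "nat \<Rightarrow> complex \<Rightarrow> complex" where
  "newton_coeff m s = (-1) ^ m / fact m *
     (\<Sum>l=1..m+1. of_int (stirling1_signed (m + 1) l) * eta (s + 1 - of_nat l))"

text \<open>Multiplying \<open>dpow s\<close> by \<open>m! (j choose m)\<close> gives a Stirling
  combination of Dirichlet monomials with shifted exponents. Differencing at 0 and summing over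
  \<open>k\<close> turns each monomial into an eta value; the sum over \<open>l\<close> is
  finite.\<close>

lemma newton_coeff_sums:
  "(\<lambda>k. of_nat (k choose m) / 2 ^ Suc k * fdiff (dpow s) (k - m) m) sums newton_coeff m s"
proof -
  have "of_nat (k choose m) * fdiff (dpow s) (k - m) m
      = (-1) ^ m / fact m * (\<Sum>l=1..m+1. of_int (stirling1_signed (m + 1) l) * fdiff (dpow (s + 1 - of_nat l)) k 0)" for k
  proof -
    have "(\<lambda>j. fact m * (of_nat (j choose m) * dpow s j))
        = (\<lambda>j. \<Sum>l=1..m+1. of_int (stirling1_signed (m + 1) l) * dpow (s + 1 - of_nat l) j)"
    proof
      fix j
      have "fact m * (of_nat (j choose m) * dpow s j) = (fact m * of_nat (j choose m)) * dpow s j"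
        by simp
      also have "\<dots> = (\<Sum>l=1..m+1. of_int (stirling1_signed (m + 1) l) * (of_nat (Suc j) ^ (l - 1) * dpow s j))"
        unfolding fact_mult_choose_eq_stirling sum_distrib_right by (simp add: mult_ac)
      also have "\<dots> = (\<Sum>l=1..m+1. of_int (stirling1_signed (m + 1) l) * dpow (s + 1 - of_nat l) j)"
        unfolding dpow_diff_of_nat [symmetric]
        by (intro sum.cong refl) (auto simp: of_nat_diff algebra_simps)
      finally show "fact m * (of_nat (j choose m) * dpow s j)
        = (\<Sum>l=1..m+1. of_int (stirling1_signed (m + 1) l) * dpow (s + 1 - of_nat l) j)" .
    qed
    then have "fdiff (\<lambda>j. fact m * (of_nat (j choose m) * dpow s j)) k 0
        = (\<Sum>l=1..m+1. of_int (stirling1_signed (m + 1) l) * fdiff (dpow (s + 1 - of_nat l)) k 0)"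
      by (simp only: fdiff_sum fdiff_cmult)
    then have *: "fact m * ((-1) ^ m * of_nat (k choose m) * fdiff (dpow s) (k - m) m)
        = (\<Sum>l=1..m+1. of_int (stirling1_signed (m + 1) l) * fdiff (dpow (s + 1 - of_nat l)) k 0)"
      by (simp only: fdiff_cmult fdiff_binomial_mult)
    show ?thesis unfolding * [symmetric] by (simp add: power_mult_distrib [symmetric])
  qed
  then have eq: "of_nat (k choose m) / 2 ^ Suc k * fdiff (dpow s) (k - m) m
      = (-1) ^ m / fact m * (\<Sum>l=1..m+1. of_int (stirling1_signed (m + 1) l) * (fdiff (dpow (s + 1 - of_nat l)) k 0 / 2 ^ Suc k))" for k
    unfolding times_divide_eq_right sum_divide_distrib [symmetric] by (metis times_divide_eq_left)
  show ?thesis unfolding eq newton_coeff_def by (intro sums_mult sums_sum eta_sums)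
qed

text \<open>\<open>fdiff_mult_Suc\<close> applied termwise, again with absorption. Its purpose is to
  extend the integral form from \<open>Re s > 0\<close> to \<open>Re s > -1\<close>.\<close>

lemma newton_coeff_diff_1:
  "newton_coeff m (s - 1) = of_nat (Suc m) * (newton_coeff m s - newton_coeff (Suc m) s)"
proof (rule sums_unique2 [OF newton_coeff_sums])
  have eq: "of_nat (k choose m) * fdiff (dpow (s - 1)) (k - m) m
      = of_nat (Suc m) * (of_nat (k choose m) * fdiff (dpow s) (k - m) m
          - of_nat (k choose Suc m) * fdiff (dpow s) (k - Suc m) (Suc m))" for k
  proof -
    have "dpow (s - 1) = (\<lambda>j. of_nat (Suc j) * dpow s j)"
      by (rule ext) (rule dpow_diff_1)
    then have "of_nat (k choose m) * fdiff (dpow (s - 1)) (k - m) m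
        = of_nat (Suc m) * (of_nat (k choose m) * fdiff (dpow s) (k - m) m)
          - of_nat ((k - m) * (k choose m)) * fdiff (dpow s) (k - m - 1) (Suc m)"
      by (simp only: fdiff_mult_Suc) (simp add: right_diff_distrib mult_ac del: of_nat_Suc of_nat_diff)
    also have "(k - m) * (k choose m) = Suc m * (k choose Suc m)"
      using binomial_absorb_comp [of k m] binomial_absorption [of m k] by simp
    finally show ?thesis by (simp only: of_nat_mult right_diff_distrib mult_ac diff_diff_left Suc_eq_plus1)
  qed
  have eq': "of_nat (k choose m) / 2 ^ Suc k * fdiff (dpow (s - 1)) (k - m) m
      = of_nat (Suc m) * (of_nat (k choose m) / 2 ^ Suc k * fdiff (dpow s) (k - m) m
          - of_nat (k choose Suc m) / 2 ^ Suc k * fdiff (dpow s) (k - Suc m) (Suc m))" for k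
    using eq [of k] by (simp add: field_simps del: power_Suc of_nat_Suc)
  show "(\<lambda>k. of_nat (k choose m) / 2 ^ Suc k * fdiff (dpow (s - 1)) (k - m) m)
      sums (of_nat (Suc m) * (newton_coeff m s - newton_coeff (Suc m) s))"
    unfolding eq' by (intro sums_mult sums_diff newton_coeff_sums)
qed

section \<open>Integral form of the coefficients\<close>

lemma newton_coeff_eq_mellin:
  assumes "Re s > 0"
  shows "newton_coeff m s = mellin s (\<lambda>x. (exp (-x) / (1 + exp (-x))) ^ Suc m) / Gamma s"
  by (rule sums_unique2 [OF newton_coeff_sums fdiff_dpow_sums_mellin [OF assms]])

lemma logistic_power_integrable:
  assumes "Re s > 0"
  shows "set_integrable lborel {0<..} (mellin_kernel s (\<lambda>x. (exp (-x) / (1 + exp (-x))) ^ Suc m))"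
proof (rule mellin_integrable [OF assms])
  have pos: "1 + exp (-x) > 0" for x :: real by (simp add: add_pos_pos)
  show "continuous_on {0<..} (\<lambda>x::real. (exp (-x) / (1 + exp (-x))) ^ Suc m)"
    by (intro continuous_intros) (metis pos less_irrefl)
  show "\<bar>(exp (-x) / (1 + exp (-x))) ^ Suc m\<bar> \<le> 1 * exp (-x)" if "x > 0" for x :: real
    using logistic_power_le [of x m] pos [of x] by (simp add: abs_mult power_abs)
qed

text \<open>The recurrence is used at \<open>s + 1\<close>, whose real part is positive; it brings
  in the factor \<open>m + 1\<close>, the exponent \<open>s\<close> and
  \<open>Gamma (s + 1)\<close>.\<close>

lemma newton_coeff_integral:
  assumes "Re s > -1"
  shows "newton_coeff m s = of_nat (m + 1) *
     (LBINT x:{0<..}. (of_real x powr s) * exp (- of_real x * of_nat (m + 1)) / (1 + exp (- of_real x)) ^ (m + 2))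
     / Gamma (s + 1)"
proof -
  define G where "G = (\<lambda>m (x::real). (exp (-x) / (1 + exp (-x))) ^ Suc m)"
  have s: "Re (s + 1) > 0" using assms by simp
  have "newton_coeff m s = of_nat (Suc m) * (newton_coeff m (s + 1) - newton_coeff (Suc m) (s + 1))"
    using newton_coeff_diff_1 [of m "s + 1"] by simp
  also have "\<dots> = of_nat (Suc m) * (mellin (s + 1) (G m) - mellin (s + 1) (G (Suc m))) / Gamma (s + 1)"
    unfolding newton_coeff_eq_mellin [OF s] G_def
    by (simp only: diff_divide_distrib [symmetric] times_divide_eq_right)
  also have "mellin (s + 1) (G m) - mellin (s + 1) (G (Suc m)) = mellin (s + 1) (\<lambda>x. G m x - G (Suc m) x)"
    unfolding G_def by (intro mellin_diff [symmetric] logistic_power_integrable s)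
  also have "\<dots> = (LBINT x:{0<..}. (of_real x powr s) * exp (- of_real x * of_nat (m + 1)) / (1 + exp (- of_real x)) ^ (m + 2))"
    unfolding mellin_def
  proof (rule set_lebesgue_integral_cong, simp, intro allI impI)
    fix x :: real
    define z where "z = exp (-x)"
    have z: "1 + z > 0" by (simp add: z_def add_pos_pos)
    \<comment> \<open>The difference of consecutive powers contributes one more denominator, whence
      the exponents \<open>m + 1\<close> above and \<open>m + 2\<close> below.\<close>
    have "G m x - G (Suc m) x = (z / (1 + z)) ^ Suc m * (1 - z / (1 + z))"
      by (simp only: G_def z_def power_Suc2 [of _ "Suc m"] right_diff_distrib mult_1_right)
    also have "1 - z / (1 + z) = 1 / (1 + z)" using z by (simp add: field_simps)
    also have "(z / (1 + z)) ^ Suc m * (1 / (1 + z)) = z ^ Suc m / (1 + z) ^ (m + 2)"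
      by (simp add: power_divide)
    finally have "complex_of_real (G m x - G (Suc m) x) = of_real z ^ Suc m / (1 + of_real z) ^ (m + 2)"
      by (simp only: of_real_divide of_real_power of_real_add of_real_1)
    moreover have "of_real z ^ Suc m = exp (- complex_of_real x * of_nat (m + 1))"
      using exp_of_nat_mult [of "Suc m" "- complex_of_real x"]
      by (simp add: z_def exp_of_real [symmetric] mult_ac del: power_Suc)
    moreover have "complex_of_real z = exp (- of_real x)"
      by (simp add: z_def exp_of_real [symmetric])
    ultimately show "mellin_kernel (s + 1) (\<lambda>x. G m x - G (Suc m) x) x
        = (of_real x powr s) * exp (- of_real x * of_nat (m + 1)) / (1 + exp (- of_real x)) ^ (m + 2)"
      by simp
  qed
  finally show ?thesis by (simp only: Suc_eq_plus1)
qed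

text \<open>The double family \<open>T\<close> is summed along rows and along columns. Its row norms
  \<open>h k\<close> are at most a polynomial in \<open>k\<close> over a power of 2, because
  \<open>diff_norm s0 k\<close> already contains the Leibniz weights.\<close>

lemma eta_add_sums: "(\<lambda>m. newton_coeff m s0 * fdiff (dpow s) m 0) sums eta (s + s0)"
proof -
  define T where "T = (\<lambda>(k, m). (of_nat (k choose m) / 2 ^ Suc k * fdiff (dpow s0) (k - m) m) * fdiff (dpow s) m 0)"
  obtain K q where K: "K \<ge> 0" "\<And>k. diff_norm s k \<le> K * (2 * real k + 1) ^ q"
    using diff_norm_poly_bound_ex [of s] by blast
  obtain K' q' where K': "K' \<ge> 0" "\<And>k. diff_norm s0 k \<le> K' * (2 * real k + 1) ^ q'"
    using diff_norm_poly_bound_ex [of s0] by blast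
  define h where "h = (\<lambda>k. \<Sum>m\<le>k. norm (T (k, m)))"
  have T0: "T (k, m) = 0" if "m \<notin> {..k}" for k m
    using that by (simp add: T_def binomial_eq_0)
  have h_le: "h k \<le> (K * K') * ((2 * real k + 1) ^ (q + q') / 2 ^ Suc k)" for k
  proof -
    have "h k \<le> (\<Sum>m\<le>k. real (k choose m) * norm (fdiff (dpow s0) (k - m) m) * (K * (2 * real k + 1) ^ q / 2 ^ Suc k))"
      unfolding h_def
    proof (rule sum_mono)
      fix m assume "m \<in> {..k}"
      \<comment> \<open>As \<open>m \<le> k\<close>, the factor depending on \<open>s\<close> is
        bounded uniformly along the row and can be taken out of the sum.\<close>
      then have "K * (2 * real m + 1) ^ q \<le> K * (2 * real k + 1) ^ q"
        by (intro mult_left_mono power_mono K) auto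
      then have "norm (fdiff (dpow s) m 0) \<le> K * (2 * real k + 1) ^ q"
        using norm_fdiff_dpow_le [of s m] K(2) [of m] by linarith
      then have "real (k choose m) * norm (fdiff (dpow s0) (k - m) m) / 2 ^ Suc k * norm (fdiff (dpow s) m 0)
          \<le> real (k choose m) * norm (fdiff (dpow s0) (k - m) m) / 2 ^ Suc k * (K * (2 * real k + 1) ^ q)"
        by (intro mult_left_mono) auto
      then show "norm (T (k, m)) \<le> real (k choose m) * norm (fdiff (dpow s0) (k - m) m) * (K * (2 * real k + 1) ^ q / 2 ^ Suc k)"
        by (simp add: T_def norm_mult norm_divide norm_power)
    qed
    also have "\<dots> = diff_norm s0 k * (K * (2 * real k + 1) ^ q / 2 ^ Suc k)"
      by (simp only: diff_norm_def sum_distrib_right)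
    also have "\<dots> \<le> (K' * (2 * real k + 1) ^ q') * (K * (2 * real k + 1) ^ q / 2 ^ Suc k)"
      by (intro mult_right_mono K' divide_nonneg_pos mult_nonneg_nonneg K(1)) auto
    finally show ?thesis by (simp add: power_add mult_ac)
  qed
  have h_nonneg: "h k \<ge> 0" for k by (simp add: h_def sum_nonneg)
  have "summable h"
    by (rule summable_comparison_test' [OF summable_mult [OF summable_poly_over_power2]])
       (use h_le h_nonneg in auto)
  then have "h summable_on UNIV"
    using h_nonneg by (intro norm_summable_imp_summable_on) simp
  moreover have "((\<lambda>m. norm (T (k, m))) has_sum h k) UNIV" for k
    unfolding h_def by (rule has_sum_finite_neutralI [of "{..k}"]) (use T0 in auto)
  ultimately have "(\<lambda>x. norm (T x)) summable_on (UNIV \<times> UNIV)"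
    by (intro summable_on_SigmaI [where g = h]) auto
  then have summ: "T summable_on (UNIV \<times> UNIV)"
    by (rule abs_summable_summable)
  then obtain S where S: "(T has_sum S) (UNIV \<times> UNIV)"
    by (auto simp: summable_on_def)
  \<comment> \<open>Rows: the Leibniz rule sums row \<open>k\<close> to the Hasse term of
    \<open>eta (s + s0)\<close>.\<close>
  have "((\<lambda>k. fdiff (dpow (s + s0)) k 0 / 2 ^ Suc k) has_sum S) UNIV"
  proof (rule has_sum_SigmaD [OF S])
    fix k :: nat
    have "dpow (s + s0) = (\<lambda>j. dpow s0 j * dpow s j)"
      by (rule ext) (simp add: dpow_add)
    then have "fdiff (dpow (s + s0)) k 0 / 2 ^ Suc k = (\<Sum>m\<le>k. T (k, m))"
      by (simp add: fdiff_times T_def sum_divide_distrib del: power_Suc)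
    then show "((\<lambda>m. T (k, m)) has_sum fdiff (dpow (s + s0)) k 0 / 2 ^ Suc k) UNIV"
      by (intro has_sum_finite_neutralI [of "{..k}"]) (use T0 in auto)
  qed
  then have S_eq: "S = eta (s + s0)"
    using eta_sums has_sum_imp_sums sums_unique2 by blast
  have "((\<lambda>m. newton_coeff m s0 * fdiff (dpow s) m 0) has_sum S) UNIV"
  proof (rule has_sum_SigmaD [OF S [unfolded has_sum_swap [of T]]])
    fix m :: nat
    \<comment> \<open>Unconditional summability of a column is inherited from the double family; its
      value is then read off from the ordered series in \<open>newton_coeff_sums\<close>.\<close>
    have "(\<lambda>(m, k). T (k, m)) summable_on (UNIV \<times> UNIV)"
      using summ by (simp only: summable_on_swap [of T])
    then have "(\<lambda>k. T (k, m)) summable_on UNIV"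
      by (rule summable_on_SigmaD1) simp
    then obtain L where L: "((\<lambda>k. T (k, m)) has_sum L) UNIV"
      by (auto simp: summable_on_def)
    moreover have "(\<lambda>k. T (k, m)) sums (newton_coeff m s0 * fdiff (dpow s) m 0)"
      unfolding T_def prod.case by (intro sums_mult2 newton_coeff_sums)
    ultimately have "L = newton_coeff m s0 * fdiff (dpow s) m 0"
      using has_sum_imp_sums sums_unique2 by blast
    with L show "((\<lambda>k. case (m, k) of (m, k) \<Rightarrow> T (k, m)) has_sum newton_coeff m s0 * fdiff (dpow s) m 0) UNIV"
      by simp
  qed
  then show ?thesis unfolding S_eq by (rule has_sum_imp_sums)
qed

theorem theorem3:
  shows "(\<forall>s s0 :: complex. Re s0 > -1 \<longrightarrow>
           (\<lambda>m. (of_nat (m + 1) *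
                 (LBINT x:{0<..}. (of_real x powr s0) * exp (- of_real x * of_nat (m + 1))
                                   / (1 + exp (- of_real x)) ^ (m + 2)) *
                 (\<Sum>j\<le>m. (-1) ^ j * of_nat (m choose j) / (of_nat (j + 1)) powr s))
                 / Gamma (s0 + 1))
             sums eta (s + s0)) \<and>
         (\<forall>s s0 :: complex.
           (\<lambda>m. (-1) ^ m / fact m *
                 (\<Sum>l=1..m+1. of_int (stirling1_signed (m + 1) l) * eta (s0 + 1 - of_nat l)) *
                 (\<Sum>j\<le>m. (-1) ^ j * of_nat (m choose j) / (of_nat (j + 1)) powr s))
             sums eta (s + s0))"
proof -
  \<comment> \<open>Both formulas share this inner sum, so they are \<open>eta_add_sums\<close> with
    the coefficient written as an integral or as a Stirling sum.\<close>
  have A: "(\<Sum>j\<le>m. (-1) ^ j * of_nat (m choose j) / (of_nat (j + 1)) powr s) = fdiff (dpow s) m 0" for m s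
    by (simp add: fdiff_def dpow_def powr_minus divide_inverse)
  show ?thesis
  proof (intro conjI allI impI)
    fix s s0 :: complex assume s0: "Re s0 > -1"
    show "(\<lambda>m. (of_nat (m + 1) *
                 (LBINT x:{0<..}. (of_real x powr s0) * exp (- of_real x * of_nat (m + 1))
                                   / (1 + exp (- of_real x)) ^ (m + 2)) *
                 (\<Sum>j\<le>m. (-1) ^ j * of_nat (m choose j) / (of_nat (j + 1)) powr s))
                 / Gamma (s0 + 1))
             sums eta (s + s0)"
      using eta_add_sums [of s0 s] unfolding A newton_coeff_integral [OF s0] times_divide_eq_left .
  next
    fix s s0 :: complex
    show "(\<lambda>m. (-1) ^ m / fact m *
                 (\<Sum>l=1..m+1. of_int (stirling1_signed (m + 1) l) * eta (s0 + 1 - of_nat l)) *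
                 (\<Sum>j\<le>m. (-1) ^ j * of_nat (m choose j) / (of_nat (j + 1)) powr s))
             sums eta (s + s0)"
      using eta_add_sums [of s0 s] unfolding A newton_coeff_def .
  qed
qed

end
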